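(* Let $G$ be a connected finite $\delta$-hyperbolic graph and let $\{x,y\}$ be a mutually distant pair of vertices. Every vertex $c$ satisfies $\max\{d(x,c),d(y,c)\}\le e(c)\le\max\{d(x,c),d(y,c)\}+2\delta$. Moreover, every vertex $c^*\in S_{\lfloor d(x,y)/2\rfloor}(x,y)\cup S_{\lfloor d(x,y)/2\rfloor}(y,x)$ has $e(c^* )\le\lceil d(x,y)/2\rceil+2\delta\le rad(G)+2\delta$. In particular, $diam(G)\ge d(x,y)\ge 2rad(G)-4\delta-1$.
   Context: $G$ is $\delta$-hyperbolic if for any four vertices $u,v,w,x$ the two larger of $d(u,v)+d(w,x)$, $d(u,w)+d(v,x)$, $d(u,x)+d(v,w)$ differ by at most $2\delta$ ($d$ = shortest-path distance). $e(v)=\max_u d(v,u)$, $F(v)=\{u: d(u,v)=e(v)\}$, $rad(G)=\min_v e(v)$, $diam(G)=\max_v e(v)$. $\{x,y\}$ is mutually distant if $x\in F(y)$ and $y\in F(x)$. $I(x,y)=\{z: d(x,z)+d(z,y)=d(x,y)\}$ and $S_k(x,y)=\{v\in I(x,y): d(v,x)=k\}$. *)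

theory Defs
  imports Complex_Main "Graph_Theory.Graph_Theory"
begin

definition gdist :: "('a, 'b) pre_digraph \<Rightarrow> 'a \<Rightarrow> 'a \<Rightarrow> nat" where
  "gdist G u v = (LEAST n. \<exists>p. pre_digraph.awalk G u p v \<and> length p = n)"

(* gdist is the library's shortest path distance for unit arc costs; the value of gdist is
   meaningful only when v is reachable from u. *)
lemma (in wf_digraph) gdist_eq_shortest_path:
  assumes "u \<rightarrow>\<^sup>* v"
  shows "\<mu> (\<lambda>_. 1) u v = ereal (real (gdist G u v))"
proof -
  have cost: "awalk_cost (\<lambda>_. 1) p = real (length p)" for p :: "'b list"
    by (induct p) auto
  have ex: "\<exists>n p. awalk u p v \<and> length p = n"
    using assms by (auto simp: reachable_awalk)
  obtain p where p: "awalk u p v" "length p = gdist G u v"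
    using LeastI_ex[OF ex] unfolding gdist_def by blast
  have le: "gdist G u v \<le> length q" if "awalk u q v" for q
    unfolding gdist_def using that by (intro Least_le) blast
  show ?thesis
  proof (rule antisym)
    show "\<mu> (\<lambda>_. 1) u v \<le> ereal (real (gdist G u v))"
      using min_cost_le_walk_cost[OF p(1), of "\<lambda>_. 1"] p(2) by (simp add: cost)
    show "ereal (real (gdist G u v)) \<le> \<mu> (\<lambda>_. 1) u v"
      unfolding \<mu>_def by (rule INF_greatest) (auto simp: cost le)
  qed
qed

(* The list is sorted in increasing order, so entries 1 and 2 are the two larger sums.
   The four vertices need not be distinct. *)
definition hyperbolic :: "real \<Rightarrow> ('a, 'b) pre_digraph \<Rightarrow> bool" where
  "hyperbolic \<delta> G \<longleftrightarrow>
    (\<forall>u\<in>verts G. \<forall>v\<in>verts G. \<forall>w\<in>verts G. \<forall>x\<in>verts G.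
      let s = sort [gdist G u v + gdist G w x,
                    gdist G u w + gdist G v x,
                    gdist G u x + gdist G v w]
      in real (s ! 2) - real (s ! 1) \<le> 2 * \<delta>)"

definition ecc :: "('a, 'b) pre_digraph \<Rightarrow> 'a \<Rightarrow> nat" where
  "ecc G v = Max ((\<lambda>u. gdist G v u) ` verts G)"

definition furthest :: "('a, 'b) pre_digraph \<Rightarrow> 'a \<Rightarrow> 'a set" where
  "furthest G v = {u \<in> verts G. gdist G u v = ecc G v}"

definition graph_rad :: "('a, 'b) pre_digraph \<Rightarrow> nat" where
  "graph_rad G = Min (ecc G ` verts G)"

definition graph_diam :: "('a, 'b) pre_digraph \<Rightarrow> nat" where
  "graph_diam G = Max (ecc G ` verts G)"

definition mutually_distant :: "('a, 'b) pre_digraph \<Rightarrow> 'a \<Rightarrow> 'a \<Rightarrow> bool" where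
  "mutually_distant G x y \<longleftrightarrow> x \<in> furthest G y \<and> y \<in> furthest G x"

definition metric_interval :: "('a, 'b) pre_digraph \<Rightarrow> 'a \<Rightarrow> 'a \<Rightarrow> 'a set" where
  "metric_interval G x y = {z \<in> verts G. gdist G x z + gdist G z y = gdist G x y}"

definition slice :: "('a, 'b) pre_digraph \<Rightarrow> nat \<Rightarrow> 'a \<Rightarrow> 'a \<Rightarrow> 'a set" where
  "slice G k x y = {v \<in> metric_interval G x y. gdist G v x = k}"

end

(* Let u be furthest from c. As x and y are mutually distant, d(x,u) and d(y,u) are at most d(x,y),
   so the four-point condition for d(x,y) + d(c,u) against d(x,c) + d(y,u) and d(x,u) + d(y,c)
   yields d(c,u) \<le> max (d(x,c)) (d(y,c)) + 2 \<delta> after cancelling d(x,y). The other bounds follow by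
   taking c in a middle slice of I(x,y), or by the triangle inequality through a center of G. *)
theory Submission
  imports Defs
begin

context wf_digraph
begin

lemma gdist_le_length: "awalk u p v \<Longrightarrow> gdist G u v \<le> length p"
  unfolding gdist_def by (intro Least_le) blast

text \<open>Reachability makes the set of walk lengths nonempty, so the minimum is attained. Without
  it, \<open>LEAST\<close> has no witness and its value is unspecified.\<close>

lemma gdist_awalk:
  assumes "u \<rightarrow>\<^sup>* v"
  obtains p where "awalk u p v" "length p = gdist G u v"
proof -
  have "\<exists>n p. awalk u p v \<and> length p = n"
    using assms by (auto simp: reachable_awalk)
  from LeastI_ex[OF this] show ?thesis
    using that unfolding gdist_def by blast
qed

lemma gdist_triangle:
  assumes "u \<rightarrow>\<^sup>* v" "v \<rightarrow>\<^sup>* w"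
  shows "gdist G u w \<le> gdist G u v + gdist G v w"
proof -
  obtain p q where "awalk u p v" "length p = gdist G u v" "awalk v q w" "length q = gdist G v w"
    using gdist_awalk assms by metis
  then show ?thesis
    using gdist_le_length[of u "p @ q" w] awalk_appendI by fastforce
qed

end

context sym_digraph
begin

text \<open>In a symmetric digraph every arc has an opposite arc, so a walk can be retraced. The
  induction reverses the tail and appends an arc opposite to the first one. This is what makes
  \<open>gdist\<close> symmetric.\<close>

lemma awalk_reverse:
  assumes "awalk u p v"
  shows "\<exists>q. awalk v q u \<and> length q = length p"
  using assms
proof (induction p arbitrary: u)
  case Nil
  then show ?case by (auto simp: awalk_Nil_iff)
next
  case (Cons a p)
  then have a: "a \<in> arcs G" "tail G a = u" and p: "awalk (head G a) p v"
    by (auto simp: awalk_Cons_iff)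
  obtain q where q: "awalk v q (head G a)" "length q = length p"
    using Cons.IH[OF p] by blast
  have "(u, head G a) \<in> arcs_ends G"
    using a by (auto simp: arcs_ends_def arc_to_ends_def)
  then have "(head G a, u) \<in> arcs_ends G"
    using sym_arcs by (auto simp: symmetric_def dest: symD)
  then obtain b where b: "b \<in> arcs G" "tail G b = head G a" "head G b = u"
    by (auto simp: arcs_ends_def arc_to_ends_def)
  then have "awalk (head G a) [b] u"
    by (auto simp: awalk_Cons_iff awalk_Nil_iff)
  with q have "awalk v (q @ [b]) u" "length (q @ [b]) = length (a # p)"
    by (auto intro: awalk_appendI)
  then show ?case by blast
qed

lemma gdist_commute:
  assumes "u \<rightarrow>\<^sup>* v"
  shows "gdist G u v = gdist G v u"
proof -
  have le: "gdist G b a \<le> gdist G a b" if "a \<rightarrow>\<^sup>* b" for a b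
    by (metis gdist_awalk[OF that] awalk_reverse gdist_le_length)
  have "v \<rightarrow>\<^sup>* u"
    using assms awalk_reverse by (metis reachable_awalk)
  with assms le show ?thesis by (simp add: antisym)
qed

text \<open>Cut a shortest walk after \<open>k\<close> arcs. The pieces bound the distances from the
  cut vertex to the two ends by \<open>k\<close> and \<open>gdist G u v - k\<close>, and the
  triangle inequality forces equality in both bounds.\<close>

lemma slice_nonempty:
  assumes "u \<rightarrow>\<^sup>* v" "k \<le> gdist G u v"
  shows "slice G k u v \<noteq> {}"
proof -
  obtain p where p: "awalk u p v" "length p = gdist G u v"
    using gdist_awalk[OF assms(1)] .
  define w where "w = awlast u (take k p)"
  have "awalk u (take k p @ drop k p) v" using p by simp
  then have w: "awalk u (take k p) w" "awalk w (drop k p) v"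
    unfolding w_def by (auto simp del: append_take_drop_id)
  have reach: "u \<rightarrow>\<^sup>* w" "w \<rightarrow>\<^sup>* v"
    using w by (auto simp: reachable_awalk)
  have "gdist G u w \<le> k" "gdist G w v \<le> gdist G u v - k"
    using gdist_le_length[OF w(1)] gdist_le_length[OF w(2)] p by auto
  then have "gdist G u w = k" "gdist G u w + gdist G w v = gdist G u v"
    using gdist_triangle[OF reach] assms(2) by auto
  moreover have "w \<in> verts G" using w by auto
  ultimately have "w \<in> slice G k u v"
    using gdist_commute[OF reach(1)] by (simp add: slice_def metric_interval_def)
  then show ?thesis by blast
qed

end

context fin_digraph
begin

lemma gdist_le_ecc: "u \<in> verts G \<Longrightarrow> gdist G v u \<le> ecc G v"
  unfolding ecc_def by (intro Max_ge) auto

lemma ecc_attained: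
  assumes "verts G \<noteq> {}"
  obtains u where "u \<in> verts G" "gdist G v u = ecc G v"
proof -
  have "ecc G v \<in> (\<lambda>u. gdist G v u) ` verts G"
    unfolding ecc_def using assms by (intro Max_in) auto
  then show ?thesis using that by auto
qed

lemma graph_rad_le_ecc: "v \<in> verts G \<Longrightarrow> graph_rad G \<le> ecc G v"
  unfolding graph_rad_def by (intro Min_le) auto

lemma graph_rad_attained:
  assumes "verts G \<noteq> {}"
  obtains v where "v \<in> verts G" "ecc G v = graph_rad G"
proof -
  have "graph_rad G \<in> ecc G ` verts G"
    unfolding graph_rad_def using assms by (intro Min_in) auto
  then show ?thesis using that by auto
qed

lemma ecc_le_graph_diam: "v \<in> verts G \<Longrightarrow> ecc G v \<le> graph_diam G"
  unfolding graph_diam_def by (intro Max_ge) auto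

end

text \<open>If \<open>a\<close> is the largest entry, then \<open>max b c\<close> is the middle one
  and the gap bound is the claim. Otherwise \<open>a\<close> is at most \<open>max b c\<close>, and
  \<open>d\<close> is nonnegative because it bounds a gap in a sorted list.\<close>

lemma sort3_gap:
  fixes a b c :: nat
  assumes "real (sort [a, b, c] ! 2) - real (sort [a, b, c] ! 1) \<le> d"
  shows "real a \<le> max (real b) (real c) + d"
  using assms by (auto simp: max_def numeral_2_eq_2 split: if_splits)

lemma hyperbolic_four_point:
  assumes "hyperbolic \<delta> G" "u \<in> verts G" "v \<in> verts G" "w \<in> verts G" "x \<in> verts G"
  shows "real (gdist G u v + gdist G w x)
    \<le> max (real (gdist G u w + gdist G v x)) (real (gdist G u x + gdist G v w)) + 2 * \<delta>"
  using assms unfolding hyperbolic_def Let_def by (intro sort3_gap) blast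

theorem theorem29:
  fixes G :: "('a, 'b) pre_digraph" and \<delta> :: real and x y :: 'a
  assumes "graph G"
    and "Digraph_Component.connected G"
    and "hyperbolic \<delta> G"
    and "x \<in> verts G" and "y \<in> verts G"
    and "mutually_distant G x y"
  shows "(\<forall>c \<in> verts G.
            max (gdist G x c) (gdist G y c) \<le> ecc G c \<and>
            real (ecc G c) \<le> real (max (gdist G x c) (gdist G y c)) + 2 * \<delta>)
       \<and> (\<forall>c \<in> slice G (nat \<lfloor>real (gdist G x y) / 2\<rfloor>) x y \<union>
                slice G (nat \<lfloor>real (gdist G x y) / 2\<rfloor>) y x.
            real (ecc G c) \<le> real_of_int \<lceil>real (gdist G x y) / 2\<rceil> + 2 * \<delta>)
       \<and> real_of_int \<lceil>real (gdist G x y) / 2\<rceil> + 2 * \<delta> \<le> real (graph_rad G) + 2 * \<delta>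
       \<and> gdist G x y \<le> graph_diam G
       \<and> 2 * real (graph_rad G) - 4 * \<delta> - 1 \<le> real (gdist G x y)"
proof -
  interpret graph G by fact
  note xy = assms(4,5)
  have ne: "verts G \<noteq> {}" using xy by auto
  \<comment> \<open>In a symmetric digraph connectedness is strong connectedness, so every
    \<open>gdist\<close> between vertices is attained by a walk.\<close>
  have reach: "u \<rightarrow>\<^sup>*\<^bsub>G\<^esub> v" if "u \<in> verts G" "v \<in> verts G" for u v
    using symmetric_connected_imp_strongly_connected[OF sym_arcs assms(2)] that by auto
  have comm: "gdist G u v = gdist G v u" if "u \<in> verts G" "v \<in> verts G" for u v
    using gdist_commute reach that by blast
  let ?n = "gdist G x y"
  \<comment> \<open>Mutual distance says that \<open>ecc G x\<close> and \<open>ecc G y\<close> both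
    equal \<open>?n\<close>.\<close>
  have far: "gdist G x u \<le> ?n" "gdist G y u \<le> ?n" if "u \<in> verts G" for u
    using gdist_le_ecc[OF that, of x] gdist_le_ecc[OF that, of y] assms(6) comm[OF xy]
    by (auto simp: mutually_distant_def furthest_def)
  have lower: "max (gdist G x c) (gdist G y c) \<le> ecc G c" if "c \<in> verts G" for c
    using gdist_le_ecc[OF xy(1), of c] gdist_le_ecc[OF xy(2), of c]
      comm[OF xy(1) that] comm[OF xy(2) that] by simp
  have upper: "real (ecc G c) \<le> real (max (gdist G x c) (gdist G y c)) + 2 * \<delta>"
    if c: "c \<in> verts G" for c
  proof -
    obtain u where u: "u \<in> verts G" "gdist G c u = ecc G c"
      using ecc_attained[OF ne] .
    show ?thesis
      using hyperbolic_four_point[OF assms(3) xy c u(1)] far[OF u(1)] u(2)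
      by linarith
  qed
  have floor: "nat \<lfloor>real ?n / 2\<rfloor> = ?n div 2"
    by linarith
  have ceil: "real_of_int \<lceil>real ?n / 2\<rceil> = real (?n - ?n div 2)"
  proof -
    \<comment> \<open>With k = \<open>?n - ?n div 2\<close> these read 2k - 2 < n \<le> 2k, that is
      k - 1 < n/2 \<le> k, which characterizes the ceiling.\<close>
    have "real (2 * (?n - ?n div 2)) - 2 < real ?n" "real ?n \<le> real (2 * (?n - ?n div 2))"
      by linarith+
    then have "\<lceil>real ?n / 2\<rceil> = int (?n - ?n div 2)"
      by (intro ceiling_unique) simp_all
    then show ?thesis by simp
  qed
  have slice: "real (ecc G c) \<le> real (?n - ?n div 2) + 2 * \<delta>"
    if c: "c \<in> slice G (?n div 2) x y \<union> slice G (?n div 2) y x" for c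
  proof -
    have cv: "c \<in> verts G"
      using c by (auto simp: slice_def metric_interval_def)
    \<comment> \<open>One end is at distance \<open>?n div 2\<close> from \<open>c\<close> and the
      other at the remaining distance, which is the larger one whichever end the slice is counted
      from.\<close>
    have "max (gdist G x c) (gdist G y c) = ?n - ?n div 2"
      using c comm[OF xy] comm[OF cv xy(1)] comm[OF cv xy(2)]
      by (auto simp: slice_def metric_interval_def)
    with upper[OF cv] show ?thesis by simp
  qed
  have rad: "?n - ?n div 2 \<le> graph_rad G"
  proof -
    obtain v where v: "v \<in> verts G" "ecc G v = graph_rad G"
      using graph_rad_attained[OF ne] .
    \<comment> \<open>Both summands are at most the radius, so n is at most twice the radius;
      integrality allows rounding n/2 up.\<close>
    have "?n \<le> gdist G x v + gdist G y v"
      using gdist_triangle[OF reach reach, of x v y] comm[of v y] v xy by simp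
    with lower[OF v(1)] v(2) show ?thesis by linarith
  qed
  \<comment> \<open>An actual middle vertex is needed to turn the bound on slices into a bound on
    the radius.\<close>
  obtain c where c: "c \<in> slice G (?n div 2) x y"
    using slice_nonempty[OF reach[OF xy], of "?n div 2"] by auto
  have "graph_rad G \<le> ecc G c"
    using c by (intro graph_rad_le_ecc) (auto simp: slice_def metric_interval_def)
  then have gap: "real (graph_rad G) \<le> real (?n - ?n div 2) + 2 * \<delta>"
    using slice[of c] c by simp
  \<comment> \<open>Doubling \<open>gap\<close> turns 2\<delta> into 4\<delta>, and rounding n/2 up
    accounts for the remaining 1.\<close>
  moreover have "2 * (?n - ?n div 2) \<le> ?n + 1"
    by presburger
  ultimately have "2 * real (graph_rad G) - 4 * \<delta> - 1 \<le> real ?n"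
    by linarith
  moreover have "?n \<le> graph_diam G"
    using gdist_le_ecc[OF xy(2)] ecc_le_graph_diam[OF xy(1)] le_trans by blast
  ultimately show ?thesis
    unfolding floor ceil using lower upper slice rad by auto
qed

end
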